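(* Let $G$ be a finite simple graph on the vertex set $[n]=\{1,\ldots,n\}$, let $K$ be a field with $\operatorname{char} K \neq 2$, and let $\mathcal{I}_G \subseteq S = K[x_1,\ldots,x_n,y_1,\ldots,y_n]$ be the parity binomial edge ideal of $G$. If $\mathcal{I}_G^{(t)} = \mathcal{I}_G^t$ for every integer $t \geq 1$, then $G$ is PT-free.
   Context: For a finite simple graph $G$ with vertex set $V(G)=[n]$ and edge set $E(G)$, and a field $K$, let $S = K[x_1,\ldots,x_n,y_1,\ldots,y_n]$ be the polynomial ring in $2n$ variables. The parity binomial edge ideal of $G$ is $\mathcal{I}_G = (x_i x_j - y_i y_j : \{i,j\}\in E(G)) \subseteq S$. Symbolic powers: if $\mathfrak{p}_1,\ldots,\mathfrak{p}_r$ are the minimal primes of an ideal $I$ in a Noetherian ring, then the $m$-th symbolic power of $I$ is $I^{(m)} = \mathfrak{q}_1\cap\cdots\cap\mathfrak{q}_r$, where $\mathfrak{q}_i$ is the $\mathfrak{p}_i$-primary component of the ordinary power $I^m$. A PT is a graph consisting of a pentagon (cycle of length 5) and a triangle sharing an edge, i.e. a graph isomorphic to the graph on the vertices $1,\ldots,6$ with edge set $\{\{1,2\},\{2,3\},\{3,4\},\{4,5\},\{5,6\},\{1,6\},\{1,5\}\}$. A graph is PT-free if it does not contain a PT as an induced subgraph. *)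

theory Defs
  imports "HOL-Algebra.Ideal_Product" "HOL-Library.Poly_Mapping"
begin

section \<open>Graphs\<close>

text \<open>A graph is a vertex set together with a set of edges, each edge being a two-element
  set of vertices.\<close>

definition finite_simple_graph :: "'v set \<Rightarrow> 'v set set \<Rightarrow> bool"
  where "finite_simple_graph V E \<longleftrightarrow> finite V \<and> (\<forall>e\<in>E. e \<subseteq> V \<and> card e = 2)"

definition induced_edges :: "'v set set \<Rightarrow> 'v set \<Rightarrow> 'v set set"
  where "induced_edges E W = {e \<in> E. e \<subseteq> W}"

definition graph_isomorphic ::
    "'v set \<Rightarrow> 'v set set \<Rightarrow> 'w set \<Rightarrow> 'w set set \<Rightarrow> bool"
  where "graph_isomorphic V E V' E' \<longleftrightarrow>
    (\<exists>f. bij_betw f V V' \<and> (\<forall>u\<in>V. \<forall>v\<in>V. {u, v} \<in> E \<longleftrightarrow> {f u, f v} \<in> E'))"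

definition PT_edges :: "nat set set"
  where "PT_edges = {{1,2}, {2,3}, {3,4}, {4,5}, {5,6}, {1,6}, {1,5}}"

definition is_PT :: "'v set \<Rightarrow> 'v set set \<Rightarrow> bool"
  where "is_PT V E \<longleftrightarrow> graph_isomorphic V E {1..6} PT_edges"

definition PT_free :: "'v set \<Rightarrow> 'v set set \<Rightarrow> bool"
  where "PT_free V E \<longleftrightarrow> \<not> (\<exists>W\<subseteq>V. is_PT W (induced_edges E W))"


section \<open>Primary decomposition and symbolic powers\<close>

definition radical_of :: "('a, 'b) ring_scheme \<Rightarrow> 'a set \<Rightarrow> 'a set"
  where "radical_of R I = {a \<in> carrier R. \<exists>k::nat. k \<ge> 1 \<and> a [^]\<^bsub>R\<^esub> k \<in> I}"

definition primary_ideal :: "('a, 'b) ring_scheme \<Rightarrow> 'a set \<Rightarrow> bool"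
  where "primary_ideal R Q \<longleftrightarrow>
    ideal Q R \<and> Q \<noteq> carrier R \<and>
    (\<forall>a\<in>carrier R. \<forall>b\<in>carrier R.
       a \<otimes>\<^bsub>R\<^esub> b \<in> Q \<longrightarrow> a \<in> Q \<or> (\<exists>k::nat. k \<ge> 1 \<and> b [^]\<^bsub>R\<^esub> k \<in> Q))"

definition minimal_prime_of :: "('a, 'b) ring_scheme \<Rightarrow> 'a set \<Rightarrow> 'a set \<Rightarrow> bool"
  where "minimal_prime_of R I P \<longleftrightarrow>
    primeideal P R \<and> I \<subseteq> P \<and> (\<forall>P'. primeideal P' R \<and> I \<subseteq> P' \<and> P' \<subseteq> P \<longrightarrow> P' = P)"

text \<open>The intersection with the carrier only matters for an empty family, whose intersection
  is the whole ring.\<close>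

definition minimal_primary_decomposition ::
    "('a, 'b) ring_scheme \<Rightarrow> 'a set \<Rightarrow> 'a set set \<Rightarrow> bool"
  where "minimal_primary_decomposition R J D \<longleftrightarrow>
    finite D \<and> (\<forall>Q\<in>D. primary_ideal R Q) \<and>
    carrier R \<inter> \<Inter>D = J \<and>
    inj_on (radical_of R) D \<and>
    (\<forall>Q\<in>D. carrier R \<inter> \<Inter>(D - {Q}) \<noteq> J)"

definition primary_component ::
    "('a, 'b) ring_scheme \<Rightarrow> 'a set \<Rightarrow> 'a set \<Rightarrow> 'a set \<Rightarrow> bool"
  where "primary_component R J P Q \<longleftrightarrow>
    (\<exists>D. minimal_primary_decomposition R J D \<and> Q \<in> D \<and> radical_of R Q = P)"

abbreviation ideal_power :: "('a, 'b) ring_scheme \<Rightarrow> 'a set \<Rightarrow> nat \<Rightarrow> 'a set"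
  where "ideal_power R I m \<equiv> I [^]\<^bsub>ideals_set R\<^esub> m"

text \<open>For \<open>m \<ge> 1\<close> the minimal primes \<open>P\<close> of \<open>I\<close> are also those of the \<open>m\<close>-th power of \<open>I\<close>,
  so in a Noetherian ring the \<open>P\<close>-primary component \<open>Q\<close> of that power exists and does not
  depend on the chosen minimal primary decomposition. Exactly one \<open>Q\<close> is therefore
  intersected for each \<open>P\<close>.\<close>

definition symbolic_power :: "('a, 'b) ring_scheme \<Rightarrow> 'a set \<Rightarrow> nat \<Rightarrow> 'a set"
  where "symbolic_power R I m =
    carrier R \<inter>
    \<Inter>{Q. \<exists>P. minimal_prime_of R I P \<and> primary_component R (ideal_power R I m) P Q}"


section \<open>Parity binomial edge ideals\<close>

datatype var = xvar nat | yvar nat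

type_synonym 'k mpoly = "(var \<Rightarrow>\<^sub>0 nat) \<Rightarrow>\<^sub>0 'k"

definition pvars :: "nat \<Rightarrow> var set"
  where "pvars n = xvar ` {1..n} \<union> yvar ` {1..n}"

definition poly_var :: "var \<Rightarrow> 'k::field mpoly"
  where "poly_var v = Poly_Mapping.single (Poly_Mapping.single v 1) 1"

text \<open>The polynomial ring in the \<open>2n\<close> variables \<open>pvars n\<close>: the type \<open>'k mpoly\<close> has
  infinitely many variables, and the carrier consists of the polynomials all of whose
  monomials involve only variables from \<open>pvars n\<close>.\<close>

definition poly_ring :: "nat \<Rightarrow> 'k::field mpoly ring"
  where "poly_ring n =
    \<lparr>carrier = {p. \<forall>m\<in>Poly_Mapping.keys p. Poly_Mapping.keys m \<subseteq> pvars n},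
     mult = (*), one = 1, zero = 0, add = (+)\<rparr>"

definition parity_binomial_edge_ideal :: "nat \<Rightarrow> nat set set \<Rightarrow> 'k::field mpoly set"
  where "parity_binomial_edge_ideal n E =
    Idl\<^bsub>poly_ring n\<^esub>
      {poly_var (xvar i) * poly_var (xvar j) - poly_var (yvar i) * poly_var (yvar j) | i j. {i, j} \<in> E}"

lemma poly_ring_simps [simp]:
  "p \<oplus>\<^bsub>poly_ring n\<^esub> q = p + q" "p \<otimes>\<^bsub>poly_ring n\<^esub> q = p * q"
  "\<zero>\<^bsub>poly_ring n\<^esub> = 0" "\<one>\<^bsub>poly_ring n\<^esub> = 1"
  by (simp_all add: poly_ring_def)

lemma poly_ring_carrier_iff:
  "p \<in> carrier (poly_ring n) \<longleftrightarrow>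
    (\<forall>m\<in>Poly_Mapping.keys p. Poly_Mapping.keys m \<subseteq> pvars n)"
  by (simp add: poly_ring_def)

lemma poly_ring_cring: "cring (poly_ring n :: 'k::field mpoly ring)"
proof (rule cringI)
  let ?R = "poly_ring n :: 'k mpoly ring"
  have zero: "0 \<in> carrier ?R" and one: "1 \<in> carrier ?R"
    by (simp_all add: poly_ring_carrier_iff)
  have uminus: "- p \<in> carrier ?R" if "p \<in> carrier ?R" for p
    using that by (simp add: poly_ring_carrier_iff)
  have plus: "p + q \<in> carrier ?R" if "p \<in> carrier ?R" "q \<in> carrier ?R" for p q
    using that Poly_Mapping.keys_add[of p q] by (auto simp only: poly_ring_carrier_iff)
  have mult: "p * q \<in> carrier ?R" if p: "p \<in> carrier ?R" and q: "q \<in> carrier ?R" for p q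
    unfolding poly_ring_carrier_iff
  proof
    fix m assume "m \<in> Poly_Mapping.keys (p * q)"
    then obtain a b where ab: "a \<in> Poly_Mapping.keys p" "b \<in> Poly_Mapping.keys q" "m = a + b"
      using keys_mult[of p q] by blast
    have "Poly_Mapping.keys a \<subseteq> pvars n" "Poly_Mapping.keys b \<subseteq> pvars n"
      using ab p q unfolding poly_ring_carrier_iff by blast+
    then show "Poly_Mapping.keys m \<subseteq> pvars n"
      using Poly_Mapping.keys_add[of a b] ab(3) by blast
  qed
  show "abelian_group ?R"
  proof (rule abelian_groupI, unfold poly_ring_simps)
    fix x assume "x \<in> carrier ?R"
    then show "\<exists>y\<in>carrier ?R. y + x = 0"
      using uminus by (intro bexI[of _ "- x"]) simp_all
  qed (simp_all add: plus zero add.assoc add.commute)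
  show "comm_monoid ?R"
    by (rule comm_monoidI) (simp_all add: mult one mult.assoc mult.commute)
qed (simp add: distrib_right)

end

theory Submission
  imports Defs "HOL-Computational_Algebra.Polynomial"
begin

text \<open>
  An induced PT on vertices \<open>w 1, \<dots>, w 6\<close> makes the second symbolic power of the ideal
  \<open>I = \<I>\<^sub>G\<close> larger than \<open>I\<^sup>2\<close>. Write \<open>g i j = x\<^sub>i x\<^sub>j - y\<^sub>i y\<^sub>j\<close> and \<open>d i j = x\<^sub>i y\<^sub>j - y\<^sub>i x\<^sub>j\<close>
  (\<open>parity_binomial\<close> and \<open>minor\<close>), and number the vertices of the PT by \<open>1, \<dots>, 6\<close>. The polynomial
  that separates the two ideals is \<open>f = g 1 5 * h\<close> with \<open>h = d 4 6 * y\<^sub>2 * x\<^sub>3\<close>: the binomial of the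
  edge common to the pentagon and the triangle, times a cofactor \<open>h\<close> for which \<open>h x\<^sub>1\<close>, \<open>h y\<^sub>1\<close>,
  \<open>h x\<^sub>5\<close>, \<open>h y\<^sub>5\<close> all lie in \<open>I\<close>. These memberships come from the two even walks \<open>4-5-6\<close> and
  \<open>4-3-2-1-6\<close> between \<open>4\<close> and \<open>6\<close>, since for two edges \<open>{i, j}\<close>, \<open>{i, k}\<close> the products
  \<open>x\<^sub>i * d j k\<close> and \<open>y\<^sub>i * d j k\<close> lie in \<open>I\<close>.

  Membership in the symbolic power can be tested after localising: it suffices that for each
  minimal prime \<open>P\<close> of \<open>I\<close> some \<open>s \<notin> P\<close> satisfies \<open>s f \<in> I\<^sup>2\<close>. If one of \<open>x\<^sub>1, y\<^sub>1, x\<^sub>5, y\<^sub>5\<close> is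
  outside \<open>P\<close>, it serves as \<open>s\<close>, because then \<open>s f = g 1 5 * (s h)\<close> is a product of two elements
  of \<open>I\<close>. Otherwise both vertices \<open>1\<close> and \<open>5\<close> vanish identically on the component of \<open>P\<close>. Such a
  vertex \<open>i\<close> must have neighbours \<open>j\<close>, \<open>k\<close> with \<open>d j k \<notin> P\<close>
  (\<open>minimal_prime_nonproportional_neighbours\<close>): if all its neighbours were proportional on the
  component, the point at \<open>i\<close> could be moved away from the origin along a line without leaving the
  zero set of \<open>I\<close>, so the component would not be maximal. Hence \<open>x\<^sub>i\<close> and \<open>y\<^sub>i\<close> are multiplied
  into \<open>I\<close> by an element outside \<open>P\<close>; doing this at \<open>1\<close> and at \<open>5\<close> multiplies \<open>g 1 5\<close> into
  \<open>I\<^sup>2\<close>.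

  That \<open>f \<notin> I\<^sup>2\<close> is seen on a single arc through a point of the zero set
  (\<open>PT_polynomial_not_mem_square\<close>): a substitution of polynomials in one variable \<open>z\<close> for the \<open>x\<^sub>i\<close>
  and \<open>y\<^sub>i\<close> along which every generator of \<open>I\<close> is divisible by \<open>z\<^sup>2\<close>, whereas \<open>f\<close> becomes
  \<open>- z\<^sup>3\<close>.
\<close>

section \<open>Symbolic powers and localisation\<close>

text \<open>A multiplier \<open>s\<close> outside the radical of a primary ideal can be cancelled modulo that ideal,
  so elements that lie in the ordinary power locally at \<open>P\<close> lie in its \<open>P\<close>-primary component.\<close>

lemma mem_symbolic_power_if_locally_mem_ideal_power:
  assumes f: "f \<in> carrier R"
    and local: "\<And>P. minimal_prime_of R I P \<Longrightarrow>
      \<exists>s\<in>carrier R - P. f \<otimes>\<^bsub>R\<^esub> s \<in> ideal_power R I m"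
  shows "f \<in> symbolic_power R I m"
  unfolding symbolic_power_def
proof (intro IntI f InterI)
  fix Q assume "Q \<in> {Q. \<exists>P. minimal_prime_of R I P \<and> primary_component R (ideal_power R I m) P Q}"
  then obtain P D where P: "minimal_prime_of R I P" and Q: "Q \<in> D" "radical_of R Q = P"
    and D: "minimal_primary_decomposition R (ideal_power R I m) D"
    unfolding primary_component_def by blast
  obtain s where s: "s \<in> carrier R" "s \<notin> P" "f \<otimes>\<^bsub>R\<^esub> s \<in> ideal_power R I m"
    using local[OF P] by blast
  have "primary_ideal R Q" "ideal_power R I m \<subseteq> Q"
    using D Q(1) unfolding minimal_primary_decomposition_def by blast+
  then have "f \<in> Q \<or> (\<exists>k::nat. k \<ge> 1 \<and> s [^]\<^bsub>R\<^esub> k \<in> Q)"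
    using f s unfolding primary_ideal_def by blast
  then show "f \<in> Q"
    using s(1,2) Q(2) unfolding radical_of_def by blast
qed

lemma (in cring) ideal_power_2:
  assumes "ideal I R"
  shows "ideal_power R I 2 = ideal_prod R I I"
proof -
  interpret ideals: comm_monoid "ideals_set R"
    by (rule ideals_set_is_comm_monoid)
  have "I \<in> carrier (ideals_set R)"
    using assms by (simp add: ideals_set_def)
  then have "ideal_power R I 2 = I \<otimes>\<^bsub>ideals_set R\<^esub> I"
    by (simp add: numeral_2_eq_2)
  then show ?thesis
    by (simp add: ideals_set_def)
qed

section \<open>Ideals of the polynomial ring\<close>

text \<open>The following lemmas restate the locale-based ring notions in terms of the operations of the
  type \<open>'k mpoly\<close>, so that polynomial identities can be checked by simplification in the type
  class.\<close>

abbreviation X :: "nat \<Rightarrow> 'k::field mpoly" where "X i \<equiv> poly_var (xvar i)"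
abbreviation Y :: "nat \<Rightarrow> 'k::field mpoly" where "Y i \<equiv> poly_var (yvar i)"

definition parity_binomial :: "nat \<Rightarrow> nat \<Rightarrow> 'k::field mpoly"
  where "parity_binomial i j = X i * X j - Y i * Y j"

definition minor :: "nat \<Rightarrow> nat \<Rightarrow> 'k::field mpoly"
  where "minor i j = X i * Y j - Y i * X j"

lemma poly_ring_carrier_closed:
  fixes p q :: "'k::field mpoly"
  shows "0 \<in> carrier (poly_ring n :: 'k mpoly ring)" "1 \<in> carrier (poly_ring n :: 'k mpoly ring)"
    and "p \<in> carrier (poly_ring n) \<Longrightarrow> q \<in> carrier (poly_ring n) \<Longrightarrow> p + q \<in> carrier (poly_ring n)"
    and "p \<in> carrier (poly_ring n) \<Longrightarrow> q \<in> carrier (poly_ring n) \<Longrightarrow> p * q \<in> carrier (poly_ring n)"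
    and "p \<in> carrier (poly_ring n) \<Longrightarrow> - p \<in> carrier (poly_ring n)"
    and "p \<in> carrier (poly_ring n) \<Longrightarrow> q \<in> carrier (poly_ring n) \<Longrightarrow> p - q \<in> carrier (poly_ring n)"
proof -
  interpret cring "poly_ring n :: 'k mpoly ring" by (rule poly_ring_cring)
  show "0 \<in> carrier (poly_ring n :: 'k mpoly ring)" "1 \<in> carrier (poly_ring n :: 'k mpoly ring)"
    using zero_closed one_closed by simp_all
  show add: "p + q \<in> carrier (poly_ring n)"
    if "p \<in> carrier (poly_ring n)" "q \<in> carrier (poly_ring n)" for p q :: "'k mpoly"
    using a_closed[OF that] by simp
  show "p * q \<in> carrier (poly_ring n)"
    if "p \<in> carrier (poly_ring n)" "q \<in> carrier (poly_ring n)"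
    using m_closed[OF that] by simp
  show uminus: "- p \<in> carrier (poly_ring n)" if "p \<in> carrier (poly_ring n)" for p :: "'k mpoly"
    using that by (simp add: poly_ring_carrier_iff)
  show "p - q \<in> carrier (poly_ring n)"
    if "p \<in> carrier (poly_ring n)" "q \<in> carrier (poly_ring n)"
    using add[OF that(1) uminus[OF that(2)]] by simp
qed

lemma poly_ring_carrier_var: "v \<in> pvars n \<Longrightarrow> poly_var v \<in> carrier (poly_ring n)"
  by (simp add: poly_ring_carrier_iff poly_var_def)

lemma poly_ring_carrier_X: "i \<in> {1..n} \<Longrightarrow> X i \<in> carrier (poly_ring n)"
  and poly_ring_carrier_Y: "i \<in> {1..n} \<Longrightarrow> Y i \<in> carrier (poly_ring n)"
  by (auto intro!: poly_ring_carrier_var simp: pvars_def)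

lemma poly_ring_carrier_const: "Poly_Mapping.single 0 a \<in> carrier (poly_ring n)"
  by (simp add: poly_ring_carrier_iff)

lemmas poly_ring_carrier_intros =
  poly_ring_carrier_closed poly_ring_carrier_X poly_ring_carrier_Y poly_ring_carrier_const

lemma ideal_poly_ring_closed:
  assumes I: "ideal I (poly_ring n :: 'k::field mpoly ring)"
  shows "I \<subseteq> carrier (poly_ring n)" "0 \<in> I"
    and "p \<in> I \<Longrightarrow> q \<in> I \<Longrightarrow> p + q \<in> I"
    and "p \<in> I \<Longrightarrow> q \<in> I \<Longrightarrow> p - q \<in> I"
    and "p \<in> carrier (poly_ring n) \<Longrightarrow> q \<in> I \<Longrightarrow> p * q \<in> I"
    and "p \<in> I \<Longrightarrow> q \<in> carrier (poly_ring n) \<Longrightarrow> p * q \<in> I"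
proof -
  interpret ideal I "poly_ring n :: 'k mpoly ring" by (rule I)
  show "I \<subseteq> carrier (poly_ring n)" "0 \<in> I"
    using a_subset additive_subgroup.zero_closed[OF ideal.axioms(1)[OF I]] by simp_all
  show add: "p + q \<in> I" if "p \<in> I" "q \<in> I" for p q
    using additive_subgroup.a_closed[OF ideal.axioms(1)[OF I] that] by simp
  show mult: "p * q \<in> I" if "p \<in> carrier (poly_ring n)" "q \<in> I" for p q
    using I_l_closed[OF that(2,1)] by simp
  show "p - q \<in> I" if "p \<in> I" "q \<in> I"
    using add[OF that(1) mult[OF _ that(2), of "- 1"]] by (simp add: poly_ring_carrier_closed)
  show "p * q \<in> I" if "p \<in> I" "q \<in> carrier (poly_ring n)"
    using mult[OF that(2,1)] by (simp add: mult.commute)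
qed

lemma ideal_poly_ringI:
  assumes carr: "I \<subseteq> carrier (poly_ring n :: 'k::field mpoly ring)" and zero: "0 \<in> I"
    and add: "\<And>p q. p \<in> I \<Longrightarrow> q \<in> I \<Longrightarrow> p + q \<in> I"
    and mult: "\<And>p q. p \<in> carrier (poly_ring n) \<Longrightarrow> q \<in> I \<Longrightarrow> p * q \<in> I"
  shows "ideal I (poly_ring n)"
proof (rule idealI)
  let ?R = "poly_ring n :: 'k mpoly ring"
  interpret R: cring ?R by (rule poly_ring_cring)
  show "ring ?R" by (rule R.ring_axioms)
  show "subgroup I (add_monoid ?R)"
  proof (rule group.subgroupI[OF R.a_group])
    fix p assume p: "p \<in> I"
    have "\<ominus>\<^bsub>?R\<^esub> p = - p"
      using R.minus_equality[of "- p" p] carr p by (auto simp: poly_ring_carrier_closed)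
    moreover have "- p \<in> I"
      using mult[OF _ p, of "- 1"] by (simp add: poly_ring_carrier_closed)
    ultimately show "inv\<^bsub>add_monoid ?R\<^esub> p \<in> I"
      by (simp add: a_inv_def)
  qed (use carr zero add in auto)
  show "q \<otimes>\<^bsub>?R\<^esub> p \<in> I" "p \<otimes>\<^bsub>?R\<^esub> q \<in> I"
    if "p \<in> I" "q \<in> carrier ?R" for p q
    using mult[OF that(2,1)] by (simp_all add: mult.commute)
qed

lemma primeideal_poly_ring_mult:
  assumes "primeideal P (poly_ring n :: 'k::field mpoly ring)"
    and "p \<in> carrier (poly_ring n)" "q \<in> carrier (poly_ring n)" "p * q \<in> P"
  shows "p \<in> P \<or> q \<in> P"
  using primeideal.I_prime[OF assms(1)] assms(2-4) by simp

lemma primeideal_poly_ring_one: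
  assumes P: "primeideal P (poly_ring n :: 'k::field mpoly ring)"
  shows "1 \<notin> P"
  using ideal.one_imp_carrier[OF primeideal.axioms(1)[OF P]] primeideal.I_notcarr[OF P] by auto

section \<open>Substitution homomorphisms\<close>

text \<open>The map \<open>c\<close> is the homomorphism on the coefficients. Both targets used below are univariate
  polynomial rings: over \<open>'k\<close> for an arc, and over \<open>'k mpoly\<close> for a family of points.\<close>

locale poly_subst =
  fixes c :: "'k::field \<Rightarrow> 'a::comm_ring_1" and g :: "var \<Rightarrow> 'a"
  assumes c_0: "c 0 = 0" and c_1: "c 1 = 1"
    and c_add: "c (a + b) = c a + c b" and c_mult: "c (a * b) = c a * c b"
begin

definition subst_monom :: "(var \<Rightarrow>\<^sub>0 nat) \<Rightarrow> 'a"
  where "subst_monom m = (\<Prod>v\<in>Poly_Mapping.keys m. g v ^ Poly_Mapping.lookup m v)"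

definition subst :: "'k mpoly \<Rightarrow> 'a"
  where "subst p = (\<Sum>m\<in>Poly_Mapping.keys p. c (Poly_Mapping.lookup p m) * subst_monom m)"

lemma subst_monom_superset:
  assumes "finite A" "Poly_Mapping.keys m \<subseteq> A"
  shows "subst_monom m = (\<Prod>v\<in>A. g v ^ Poly_Mapping.lookup m v)"
  unfolding subst_monom_def
  by (rule prod.mono_neutral_left) (use assms in \<open>auto simp: in_keys_iff\<close>)

lemma subst_monom_add: "subst_monom (a + b) = subst_monom a * subst_monom b"
proof -
  let ?A = "Poly_Mapping.keys a \<union> Poly_Mapping.keys b"
  have "subst_monom m = (\<Prod>v\<in>?A. g v ^ Poly_Mapping.lookup m v)"
    if "Poly_Mapping.keys m \<subseteq> ?A" for m
    using that by (intro subst_monom_superset) auto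
  then show ?thesis
    by (simp add: Poly_Mapping.keys_add lookup_add power_add prod.distrib)
qed

lemma subst_single: "subst (Poly_Mapping.single m a) = c a * subst_monom m"
  by (simp add: subst_def c_0)

lemma subst_add: "subst (p + q) = subst p + subst q"
  unfolding subst_def
  by (rule setsum_keys_plus_distrib) (simp_all add: c_0 c_add distrib_right)

lemma subst_0: "subst 0 = 0"
  by (simp add: subst_def)

lemma subst_const: "subst (Poly_Mapping.single 0 a) = c a"
  by (simp add: subst_single subst_monom_def)

lemma subst_1: "subst 1 = 1"
  using subst_const[of 1] by (simp add: c_1)

lemma subst_var: "subst (poly_var v) = g v"
  by (simp add: poly_var_def subst_single subst_monom_def c_1)

end

lemma mpoly_induct [case_names zero add_term]:
  fixes p :: "'k::field mpoly"
  assumes "Q 0"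
    and "\<And>p m a. a \<noteq> 0 \<Longrightarrow> m \<notin> Poly_Mapping.keys p \<Longrightarrow> Q p \<Longrightarrow> Q (p + Poly_Mapping.single m a)"
  shows "Q p"
proof (induction p rule: Poly_Mapping.update_induct)
  case const
  show ?case by (rule assms(1))
next
  case (update p m a)
  have "Poly_Mapping.update m a p = p + Poly_Mapping.single m a"
    using update(1)
    by (intro poly_mapping_eqI) (auto simp: lookup_update lookup_add lookup_single when_def in_keys_iff)
  then show ?case
    using assms(2) update by simp
qed

context poly_subst
begin

lemma subst_mult: "subst (p * q) = subst p * subst q"
proof (induction p rule: mpoly_induct)
  case zero
  show ?case by (simp add: subst_0)
next
  case (add_term p m a)
  have "subst (Poly_Mapping.single m a * q) = subst (Poly_Mapping.single m a) * subst q"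
  proof (induction q rule: mpoly_induct)
    case zero
    show ?case by (simp add: subst_0)
  next
    case (add_term q m' b)
    then show ?case
      by (simp add: distrib_left subst_add mult_single subst_single subst_monom_add c_mult mult.assoc
          mult.left_commute)
  qed
  with add_term show ?case
    by (simp add: distrib_right subst_add)
qed

lemma subst_uminus: "subst (- p) = - subst p"
  using subst_add[of "- p" p] by (simp add: subst_0 eq_neg_iff_add_eq_0)

lemma subst_diff: "subst (p - q) = subst p - subst q"
  using subst_add[of p "- q"] by (simp add: subst_uminus)

lemmas subst_simps = subst_0 subst_1 subst_const subst_var subst_add subst_mult subst_diff

end

lemma poly_ring_carrier_induct [consumes 1, case_names const var add mult]:
  fixes p :: "'k::field mpoly"
  assumes p: "p \<in> carrier (poly_ring n)"
    and const: "\<And>a. Q (Poly_Mapping.single 0 a)" and var: "\<And>v. v \<in> pvars n \<Longrightarrow> Q (poly_var v)"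
    and add: "\<And>p q. Q p \<Longrightarrow> Q q \<Longrightarrow> Q (p + q)" and mult: "\<And>p q. Q p \<Longrightarrow> Q q \<Longrightarrow> Q (p * q)"
  shows "Q p"
  using p
proof (induction p rule: mpoly_induct)
  case zero
  show ?case using const[of 0] by simp
next
  case (add_term p m a)
  have monom: "Q (Poly_Mapping.single m a)"
    if "Poly_Mapping.keys m \<subseteq> pvars n" for m :: "var \<Rightarrow>\<^sub>0 nat" and a :: 'k
    using that
  proof (induction m arbitrary: a rule: Poly_Mapping.update_induct)
    case const
    show ?case by (rule assms(2))
  next
    case (update m v k)
    have keys: "Poly_Mapping.keys (Poly_Mapping.update v k m) = insert v (Poly_Mapping.keys m)"
      using update(2) by (auto simp: in_keys_iff lookup_update split: if_splits)
    have "Q (Poly_Mapping.single (m + Poly_Mapping.single v j) a)" for j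
    proof (induction j)
      case 0
      show ?case using update(3)[of a] update(4) keys by simp
    next
      case (Suc j)
      have "Poly_Mapping.single (m + Poly_Mapping.single v (Suc j)) a =
          Poly_Mapping.single (m + Poly_Mapping.single v j) a * poly_var v"
        by (simp add: poly_var_def mult_single add.assoc flip: single_add)
      then show ?case
        using mult[OF Suc var[of v]] update(4) keys by simp
    qed
    moreover have "Poly_Mapping.update v k m = m + Poly_Mapping.single v k"
      using update(1)
      by (intro poly_mapping_eqI) (auto simp: lookup_update lookup_add lookup_single when_def in_keys_iff)
    ultimately show ?case by simp
  qed
  have keys: "Poly_Mapping.keys (p + Poly_Mapping.single m a) = insert m (Poly_Mapping.keys p)"
    using add_term(1,2) by (auto simp: in_keys_iff lookup_add lookup_single when_def split: if_splits)
  then have "p \<in> carrier (poly_ring n)" "Poly_Mapping.keys m \<subseteq> pvars n"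
    using add_term(4) by (simp_all add: poly_ring_carrier_iff)
  then show ?case
    using add[OF add_term(3) monom] by blast
qed

section \<open>The parity binomial edge ideal\<close>

lemma edge_vertices:
  assumes "finite_simple_graph {1..n} E" "{i, j} \<in> E"
  shows "i \<in> {1..n}" "j \<in> {1..n}" "i \<noteq> j"
proof -
  have "{i, j} \<subseteq> {1..n}" "card {i, j} = 2"
    using assms unfolding finite_simple_graph_def by blast+
  then show "i \<in> {1..n}" "j \<in> {1..n}" "i \<noteq> j" by auto
qed

lemma parity_binomial_carrier:
  assumes "i \<in> {1..n}" "j \<in> {1..n}"
  shows "parity_binomial i j \<in> carrier (poly_ring n)" "minor i j \<in> carrier (poly_ring n)"
  unfolding parity_binomial_def minor_def using assms by (intro poly_ring_carrier_intros; simp)+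

lemma parity_binomial_edge_ideal_eq:
  "parity_binomial_edge_ideal n E = Idl\<^bsub>poly_ring n\<^esub> {parity_binomial i j | i j. {i, j} \<in> E}"
  by (simp add: parity_binomial_edge_ideal_def parity_binomial_def)

lemma parity_binomial_edge_ideal:
  assumes "finite_simple_graph {1..n} E"
  shows "ideal (parity_binomial_edge_ideal n E) (poly_ring n :: 'k::field mpoly ring)" (is ?ideal)
    and "{i, j} \<in> E \<Longrightarrow> (parity_binomial i j :: 'k mpoly) \<in> parity_binomial_edge_ideal n E"
proof -
  interpret cring "poly_ring n :: 'k mpoly ring" by (rule poly_ring_cring)
  let ?B = "{parity_binomial i j | i j. {i, j} \<in> E} :: 'k mpoly set"
  have carr: "?B \<subseteq> carrier (poly_ring n)"
    using edge_vertices[OF assms] parity_binomial_carrier by blast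
  show ?ideal
    unfolding parity_binomial_edge_ideal_eq by (rule genideal_ideal[OF carr])
  show "(parity_binomial i j :: 'k mpoly) \<in> parity_binomial_edge_ideal n E" if "{i, j} \<in> E"
    using genideal_self[OF carr] that unfolding parity_binomial_edge_ideal_eq by blast
qed

lemma parity_binomial_edge_ideal_subset:
  assumes "ideal J (poly_ring n :: 'k::field mpoly ring)"
    and "\<And>i j. {i, j} \<in> E \<Longrightarrow> (parity_binomial i j :: 'k mpoly) \<in> J"
  shows "parity_binomial_edge_ideal n E \<subseteq> J"
proof -
  interpret cring "poly_ring n :: 'k mpoly ring" by (rule poly_ring_cring)
  show ?thesis
    unfolding parity_binomial_edge_ideal_eq by (rule genideal_minimal[OF assms(1)]) (use assms(2) in blast)
qed

text \<open>The two vectors at \<open>j\<close> and \<open>k\<close> are both orthogonal to \<open>(x\<^sub>i, - y\<^sub>i)\<close> modulo the ideal, so their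
  determinant is annihilated by \<open>x\<^sub>i\<close> and \<open>y\<^sub>i\<close> (Cramer's rule).\<close>

lemma vertex_times_minor_mem:
  assumes G: "finite_simple_graph {1..n} E" and e: "{i, j} \<in> E" "{i, k} \<in> E"
  defines "I \<equiv> parity_binomial_edge_ideal n E :: 'k::field mpoly set"
  shows "X i * minor j k \<in> I" "Y i * minor j k \<in> I"
proof -
  note ideal_I = ideal_poly_ring_closed[OF parity_binomial_edge_ideal(1)[OF G]]
  note gens = parity_binomial_edge_ideal(2)[OF G e(1)] parity_binomial_edge_ideal(2)[OF G e(2)]
  note carr = poly_ring_carrier_intros edge_vertices[OF G e(1)] edge_vertices[OF G e(2)]
  have "X i * minor j k = Y k * parity_binomial i j - Y j * (parity_binomial i k :: 'k mpoly)"
    "Y i * minor j k = X k * parity_binomial i j - X j * (parity_binomial i k :: 'k mpoly)"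
    by (simp_all add: minor_def parity_binomial_def algebra_simps)
  moreover have "Y k * parity_binomial i j - Y j * (parity_binomial i k :: 'k mpoly) \<in> I"
    "X k * parity_binomial i j - X j * (parity_binomial i k :: 'k mpoly) \<in> I"
    unfolding I_def by (intro ideal_I(4,5) gens carr)+
  ultimately show "X i * minor j k \<in> I" "Y i * minor j k \<in> I"
    by simp_all
qed

section \<open>Vertices that vanish on a component\<close>

text \<open>The extension of a prime \<open>P\<close> to polynomials in one more variable is prime: the product of the
  lowest coefficients outside \<open>P\<close> is a coefficient of \<open>q * r\<close> modulo \<open>P\<close>.\<close>

lemma prime_coeffs_extension:
  fixes q r :: "'k::field mpoly poly"
  assumes P: "primeideal P (poly_ring n)"
    and q: "\<And>k. coeff q k \<in> carrier (poly_ring n)" and r: "\<And>k. coeff r k \<in> carrier (poly_ring n)"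
    and qr: "\<And>k. coeff (q * r) k \<in> P"
  shows "(\<forall>k. coeff q k \<in> P) \<or> (\<forall>k. coeff r k \<in> P)"
proof (rule ccontr)
  note ideal_P = ideal_poly_ring_closed[OF primeideal.axioms(1)[OF P]]
  assume contra: "\<not> ?thesis"
  define a where "a = (LEAST k. coeff q k \<notin> P)"
  define b where "b = (LEAST k. coeff r k \<notin> P)"
  have a: "coeff q a \<notin> P" "\<And>k. k < a \<Longrightarrow> coeff q k \<in> P"
    using contra LeastI_ex[of "\<lambda>k. coeff q k \<notin> P"] not_less_Least unfolding a_def by blast+
  have b: "coeff r b \<notin> P" "\<And>k. k < b \<Longrightarrow> coeff r k \<in> P"
    using contra LeastI_ex[of "\<lambda>k. coeff r k \<notin> P"] not_less_Least unfolding b_def by blast+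
  let ?t = "\<lambda>k. coeff q k * coeff r (a + b - k)"
  have "sum ?t A \<in> P" if "finite A" "A \<subseteq> {..a + b} - {a}" for A
    using that
  proof (induction A)
    case (insert k A)
    have "k < a \<or> a + b - k < b" using insert.prems by auto
    then have "?t k \<in> P"
      using a(2) b(2) q r by (blast intro: ideal_P(5,6))
    then show ?case using insert ideal_P(3) by simp
  qed (simp add: ideal_P)
  then have "sum ?t ({..a + b} - {a}) \<in> P" by simp
  moreover have "coeff (q * r) (a + b) = ?t a + sum ?t ({..a + b} - {a})"
    unfolding coeff_mult by (rule sum.remove) auto
  ultimately have "coeff (q * r) (a + b) - sum ?t ({..a + b} - {a}) = coeff q a * coeff r b"
    by simp
  moreover have "coeff (q * r) (a + b) - sum ?t ({..a + b} - {a}) \<in> P"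
    by (intro ideal_P(4) qr) fact
  ultimately show False
    using primeideal_poly_ring_mult[OF P q r] a(1) b(1) by metis
qed

text \<open>The generic point with the pair at vertex \<open>i\<close> replaced by \<open>z * (a, b)\<close>, where \<open>z\<close> is the
  variable of the outer polynomial ring: a point moving along a line through the origin.\<close>

definition ray :: "nat \<Rightarrow> 'k::field mpoly \<Rightarrow> 'k mpoly \<Rightarrow> var \<Rightarrow> 'k mpoly poly"
  where "ray i a b v =
    (if v = xvar i then monom a 1 else if v = yvar i then monom b 1 else [:poly_var v:])"

interpretation ray: poly_subst "\<lambda>c. [:Poly_Mapping.single 0 c:]" "ray i a b"
  for i :: nat and a b :: "'k::field mpoly"
  by unfold_locales (simp_all add: single_add mult_single one_pCons mult.commute)

text \<open>Sweeping the zero set of a prime \<open>P\<close> on which vertex \<open>i\<close> vanishes along the ray in direction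
  \<open>(a, b)\<close> gives an irreducible set containing it. Its ideal is the preimage of the extension of
  \<open>P\<close> under the substitution; putting \<open>z = 0\<close> shows that it is contained in \<open>P\<close>. It is strictly
  smaller as soon as \<open>a\<close> or \<open>b\<close> is outside \<open>P\<close>.\<close>

lemma ray_prime:
  fixes P :: "'k::field mpoly set"
  assumes P: "primeideal P (poly_ring n)" and i: "i \<in> {1..n}" "X i \<in> P" "Y i \<in> P"
    and ab: "a \<in> carrier (poly_ring n)" "b \<in> carrier (poly_ring n)"
  defines "P' \<equiv> {p \<in> carrier (poly_ring n). \<forall>k. coeff (ray.subst i a b p) k \<in> P}"
  shows "primeideal P' (poly_ring n)" "P' \<subseteq> P" "X i \<in> P' \<Longrightarrow> a \<in> P" "Y i \<in> P' \<Longrightarrow> b \<in> P"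
proof -
  note ideal_P = ideal_poly_ring_closed[OF primeideal.axioms(1)[OF P]]
  let ?\<phi> = "ray.subst i a b"
  \<comment> \<open>At \<open>z = 0\<close> the substitution kills \<open>x\<^sub>i\<close> and \<open>y\<^sub>i\<close>, which changes nothing modulo \<open>P\<close>.\<close>
  have coeffs: "(\<forall>k. coeff (?\<phi> p) k \<in> carrier (poly_ring n)) \<and> coeff (?\<phi> p) 0 - p \<in> P \<and>
      p \<in> carrier (poly_ring n)" if "p \<in> carrier (poly_ring n)" for p
    using that
  proof (induction p rule: poly_ring_carrier_induct)
    case (const c)
    then show ?case
      by (auto simp: ray.subst_const coeff_pCons ideal_P poly_ring_carrier_intros split: nat.split)
  next
    case (var v)
    have "- X i \<in> P" "- Y i \<in> P"
      using ideal_P(4)[OF ideal_P(2)] i by fastforce+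
    moreover have v: "(poly_var v :: 'k mpoly) \<in> carrier (poly_ring n)"
      by (rule poly_ring_carrier_var[OF var])
    moreover have "coeff (ray i a b v) k \<in> carrier (poly_ring n)" for k
      using v ab
      by (simp add: ray_def coeff_pCons coeff_monom poly_ring_carrier_closed split: nat.split)
    ultimately show ?case
      using ideal_P(2) unfolding ray.subst_var
      by (simp add: ray_def)
  next
    case (add p q)
    have "coeff (?\<phi> (p + q)) 0 - (p + q) = (coeff (?\<phi> p) 0 - p) + (coeff (?\<phi> q) 0 - q)"
      by (simp add: ray.subst_add)
    also have "\<dots> \<in> P"
      using add by (intro ideal_P(3)) auto
    finally show ?case
      using add by (auto simp: ray.subst_add intro: poly_ring_carrier_intros)
  next
    case (mult p q)
    have sum_carr: "sum f A \<in> carrier (poly_ring n)"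
      if "\<And>x. f x \<in> carrier (poly_ring n)" for f :: "nat \<Rightarrow> 'k mpoly" and A
      using that by (induction A rule: infinite_finite_induct) (auto intro: poly_ring_carrier_intros)
    have "coeff (?\<phi> (p * q)) 0 - p * q =
        coeff (?\<phi> p) 0 * (coeff (?\<phi> q) 0 - q) + (coeff (?\<phi> p) 0 - p) * q"
      by (simp add: ray.subst_mult coeff_mult algebra_simps)
    also have "\<dots> \<in> P"
      using mult by (intro ideal_P(3) ideal_P(5) ideal_P(6)) auto
    finally show ?case
      using mult by (auto simp: ray.subst_mult coeff_mult intro!: sum_carr poly_ring_carrier_intros)
  qed
  show "P' \<subseteq> P"
  proof
    fix p assume p: "p \<in> P'"
    then have "coeff (?\<phi> p) 0 \<in> P" "coeff (?\<phi> p) 0 - p \<in> P"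
      using coeffs by (auto simp: P'_def)
    then show "p \<in> P"
      using ideal_P(4) by fastforce
  qed
  show "X i \<in> P' \<Longrightarrow> a \<in> P" "Y i \<in> P' \<Longrightarrow> b \<in> P"
    by (auto simp: P'_def ray.subst_var ray_def dest!: spec[of _ 1])
  have "ideal P' (poly_ring n)"
  proof (rule ideal_poly_ringI)
    fix p q :: "'k mpoly" assume pq: "p \<in> carrier (poly_ring n)" "q \<in> P'"
    have sum_P: "sum f A \<in> P" if "\<And>x. f x \<in> P" for f :: "nat \<Rightarrow> 'k mpoly" and A
      using that by (induction A rule: infinite_finite_induct) (auto intro: ideal_P)
    show "p * q \<in> P'"
      using pq coeffs[OF pq(1)]
      by (auto simp: P'_def ray.subst_mult coeff_mult intro!: sum_P ideal_P(5) poly_ring_carrier_intros)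
  qed (auto simp: P'_def ray.subst_0 ray.subst_add intro: poly_ring_carrier_intros ideal_P)
  then show "primeideal P' (poly_ring n)"
  proof (rule primeidealI[OF _ poly_ring_cring])
    show "carrier (poly_ring n) \<noteq> P'"
      using \<open>P' \<subseteq> P\<close> primeideal_poly_ring_one[OF P] poly_ring_carrier_closed(2) by blast
    fix p q :: "'k mpoly"
    assume "p \<in> carrier (poly_ring n)" "q \<in> carrier (poly_ring n)" "p \<otimes>\<^bsub>poly_ring n\<^esub> q \<in> P'"
    then show "p \<in> P' \<or> q \<in> P'"
      using prime_coeffs_extension[OF P, of "?\<phi> p" "?\<phi> q"] coeffs
      by (auto simp: P'_def ray.subst_mult)
  qed
qed

text \<open>If all neighbours of \<open>i\<close> were proportional on the component of \<open>P\<close>, the pair at \<open>i\<close> could be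
  moved along the line orthogonal to all of them (in the sense of the binomials), and the resulting
  prime of \<open>ray_prime\<close> would contradict the minimality of \<open>P\<close>.\<close>

lemma minimal_prime_nonproportional_neighbours:
  fixes P :: "'k::field mpoly set"
  assumes G: "finite_simple_graph {1..n} E"
    and P: "minimal_prime_of (poly_ring n) (parity_binomial_edge_ideal n E) P"
    and i: "i \<in> {1..n}" "X i \<in> P" "Y i \<in> P"
  shows "\<exists>j k. {i, j} \<in> E \<and> {i, k} \<in> E \<and> minor j k \<notin> P"
proof (rule ccontr)
  assume contra: "\<not> ?thesis"
  let ?I = "parity_binomial_edge_ideal n E :: 'k mpoly set"
  have prime: "primeideal P (poly_ring n)" and sub: "?I \<subseteq> P"
    and minimal: "\<And>P'. primeideal P' (poly_ring n) \<Longrightarrow> ?I \<subseteq> P' \<Longrightarrow> P' \<subseteq> P \<Longrightarrow> P' = P"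
    using P unfolding minimal_prime_of_def by blast+
  note ideal_P = ideal_poly_ring_closed[OF primeideal.axioms(1)[OF prime]]
  \<comment> \<open>The direction is \<open>(y\<^sub>j, x\<^sub>j)\<close> for a neighbour \<open>j\<close> that does not vanish on the component; if
    all neighbours vanish, every direction works and \<open>(1, 1)\<close> is chosen.\<close>
  obtain a b :: "'k mpoly" where ab: "a \<in> carrier (poly_ring n)" "b \<in> carrier (poly_ring n)"
    "a \<notin> P \<or> b \<notin> P" "\<And>k. {i, k} \<in> E \<Longrightarrow> a * X k - b * Y k \<in> P"
  proof (cases "\<exists>j. {i, j} \<in> E \<and> (X j \<notin> P \<or> Y j \<notin> P)")
    case True
    then obtain j where j: "{i, j} \<in> E" "X j \<notin> P \<or> Y j \<notin> P" by blast
    have "Y j * X k - X j * Y k \<in> P" if "{i, k} \<in> E" for k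
    proof -
      have "minor k j \<in> P" using contra that j(1) by blast
      then show ?thesis by (simp add: minor_def mult.commute)
    qed
    moreover have "X j \<in> carrier (poly_ring n)" "Y j \<in> carrier (poly_ring n)"
      by (intro poly_ring_carrier_intros edge_vertices[OF G j(1)])+
    ultimately show ?thesis
      using that[of "Y j" "X j"] j(2) by blast
  next
    case False
    then have "1 * X k - 1 * Y k \<in> P" if "{i, k} \<in> E" for k
      using that ideal_P(4)[of "X k" "Y k"] by simp
    then show ?thesis
      using that[of 1 1] primeideal_poly_ring_one[OF prime] poly_ring_carrier_closed(2) by blast
  qed
  let ?P' = "{p \<in> carrier (poly_ring n). \<forall>k. coeff (ray.subst i a b p) k \<in> P}"
  note P' = ray_prime[OF prime i ab(1,2)]
  have nbr: "parity_binomial i k \<in> ?P'" if "{i, k} \<in> E" for k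
  proof -
    have "ray.subst i a b (parity_binomial i k) = monom (a * X k - b * Y k) 1"
      using edge_vertices[OF G that]
      by (intro poly_eqI)
        (simp add: parity_binomial_def ray.subst_simps ray_def monom_altdef coeff_pCons split: nat.split)
    then show ?thesis
      using edge_vertices[OF G that] ab(4)[OF that] ideal_P(2)
      by (simp add: parity_binomial_carrier coeff_monom)
  qed
  have "parity_binomial k l \<in> ?P'" if "{k, l} \<in> E" for k l
  proof -
    consider "k = i" | "l = i" | "k \<noteq> i" "l \<noteq> i" by blast
    then show ?thesis
    proof cases
      case 1
      then show ?thesis using nbr that by blast
    next
      case 2
      moreover have "parity_binomial k l = (parity_binomial l k :: 'k mpoly)"
        by (simp add: parity_binomial_def mult.commute)
      ultimately show ?thesis using nbr[of k] that by (simp add: insert_commute)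
    next
      case 3
      then have "ray.subst i a b (parity_binomial k l) = [:parity_binomial k l:]"
        by (simp add: parity_binomial_def ray.subst_simps ray_def)
      moreover have "parity_binomial k l \<in> P"
        using parity_binomial_edge_ideal(2)[OF G that] sub by blast
      ultimately show ?thesis
        using edge_vertices[OF G that] ideal_P(2)
        by (simp add: parity_binomial_carrier coeff_pCons split: nat.split)
    qed
  qed
  then have "?I \<subseteq> ?P'"
    by (intro parity_binomial_edge_ideal_subset primeideal.axioms(1)[OF P'(1)])
  then have "?P' = P"
    using minimal P'(1,2) by blast
  then show False
    using P'(3,4) i ab(3) by blast
qed

section \<open>A separating polynomial\<close>

definition PT_cofactor :: "(nat \<Rightarrow> nat) \<Rightarrow> 'k::field mpoly"
  where "PT_cofactor w = minor (w 4) (w 6) * Y (w 2) * X (w 3)"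

text \<open>For vertex \<open>5\<close> the walk \<open>4-5-6\<close> suffices. For vertex \<open>1\<close> the walks \<open>2-1-6\<close> and \<open>2-3-4\<close> are
  combined by the relation
  \<open>y\<^sub>2 * minor 4 6 = y\<^sub>4 * minor 2 6 - y\<^sub>6 * minor 2 4\<close> between three vectors of the plane; the factor
  \<open>x\<^sub>3\<close> of the cofactor is what multiplies \<open>minor 2 4\<close> into the ideal.\<close>

lemma PT_cofactor_mult_mem:
  assumes G: "finite_simple_graph {1..n} E"
    and w: "\<And>i j. {i, j} \<in> PT_edges \<Longrightarrow> {w i, w j} \<in> E"
    and s: "s \<in> {X (w 1), Y (w 1), X (w 5), Y (w 5)}"
  shows "(s * PT_cofactor w :: 'k::field mpoly) \<in> parity_binomial_edge_ideal n E" (is "_ \<in> ?I")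
proof -
  note ideal_I = ideal_poly_ring_closed[OF parity_binomial_edge_ideal(1)[OF G]]
  have e: "{w 1, w 2} \<in> E" "{w 2, w 1} \<in> E" "{w 3, w 2} \<in> E" "{w 3, w 4} \<in> E"
    "{w 5, w 4} \<in> E" "{w 5, w 6} \<in> E" "{w 1, w 6} \<in> E"
    by (rule w; simp add: PT_edges_def insert_commute)+
  note carr = poly_ring_carrier_intros edge_vertices[OF G e(2)] edge_vertices[OF G e(4)] edge_vertices[OF G e(6)]
  show ?thesis
  proof (cases "s \<in> {X (w 5), Y (w 5)}")
    case True
    have "s * minor (w 4) (w 6) \<in> ?I"
      using vertex_times_minor_mem[OF G e(5,6)] True by blast
    moreover have "s * PT_cofactor w = (Y (w 2) * X (w 3)) * (s * minor (w 4) (w 6))"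
      by (simp add: PT_cofactor_def algebra_simps)
    moreover have "(Y (w 2) * X (w 3)) * (s * minor (w 4) (w 6)) \<in> ?I"
      by (intro ideal_I(5) carr calculation)
    ultimately show ?thesis
      by simp
  next
    case False
    have s26: "s * minor (w 2) (w 6) \<in> ?I"
      using vertex_times_minor_mem[OF G e(1,7)] False s by blast
    have s24: "X (w 3) * minor (w 2) (w 4) \<in> ?I"
      using vertex_times_minor_mem[OF G e(3,4)] by blast
    have "s \<in> carrier (poly_ring n)"
      using False s poly_ring_carrier_X[of "w 1" n] poly_ring_carrier_Y[of "w 1" n]
        edge_vertices[OF G e(1)] by auto
    then have "X (w 3) * Y (w 4) * (s * minor (w 2) (w 6)) - s * Y (w 6) * (X (w 3) * minor (w 2) (w 4)) \<in> ?I"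
      by (intro ideal_I(4,5) s26 s24 carr)
    moreover have "s * PT_cofactor w =
        X (w 3) * Y (w 4) * (s * minor (w 2) (w 6)) - s * Y (w 6) * (X (w 3) * minor (w 2) (w 4))"
      by (simp add: PT_cofactor_def minor_def algebra_simps)
    ultimately show ?thesis
      by simp
  qed
qed

lemma PT_polynomial_mem_symbolic_square:
  assumes G: "finite_simple_graph {1..n} E"
    and w: "\<And>i j. {i, j} \<in> PT_edges \<Longrightarrow> {w i, w j} \<in> E"
  defines "I \<equiv> parity_binomial_edge_ideal n E :: 'k::field mpoly set"
  shows "parity_binomial (w 1) (w 5) * PT_cofactor w \<in> symbolic_power (poly_ring n) I 2"
proof (rule mem_symbolic_power_if_locally_mem_ideal_power)
  interpret cring "poly_ring n :: 'k mpoly ring" by (rule poly_ring_cring)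
  have idl: "ideal I (poly_ring n)"
    unfolding I_def by (rule parity_binomial_edge_ideal(1)[OF G])
  note square_mem = ideal_prod.prod[of _ I _ I "poly_ring n", simplified]
  note square = ideal_poly_ring_closed[OF ideal_prod_is_ideal[OF idl idl]]
  have e: "{w 1, w 2} \<in> E" "{w 3, w 4} \<in> E" "{w 5, w 6} \<in> E" "{w 1, w 5} \<in> E"
    by (rule w; simp add: PT_edges_def)+
  note vert = edge_vertices[OF G e(1)] edge_vertices[OF G e(2)] edge_vertices[OF G e(3)]
  let ?g = "parity_binomial (w 1) (w 5) :: 'k mpoly" and ?h = "PT_cofactor w :: 'k mpoly"
  have g: "?g \<in> I"
    unfolding I_def by (rule parity_binomial_edge_ideal(2)[OF G e(4)])
  have h: "?h \<in> carrier (poly_ring n)"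
    unfolding PT_cofactor_def using vert
    by (intro poly_ring_carrier_intros parity_binomial_carrier)
  show "?g * ?h \<in> carrier (poly_ring n)"
    using h vert by (intro poly_ring_carrier_intros parity_binomial_carrier)
  fix P assume P: "minimal_prime_of (poly_ring n) I P"
  then have prime: "primeideal P (poly_ring n)"
    unfolding minimal_prime_of_def by blast
  let ?V = "{X (w 1), Y (w 1), X (w 5), Y (w 5)} :: 'k mpoly set"
  have "\<exists>s\<in>carrier (poly_ring n) - P. ?g * ?h * s \<in> ideal_prod (poly_ring n) I I"
  proof (cases "?V \<subseteq> P")
    case False
    then obtain s where s: "s \<in> ?V" "s \<notin> P" by blast
    have "s \<in> carrier (poly_ring n)"
      using s(1) vert by (auto intro: poly_ring_carrier_intros)
    moreover have "?g * (s * ?h) \<in> ideal_prod (poly_ring n) I I"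
      using square_mem[OF g] PT_cofactor_mult_mem[OF G w s(1)] unfolding I_def by blast
    ultimately show ?thesis
      using s(2) by (intro bexI[of _ s]) (simp_all add: ac_simps)
  next
    case True
    \<comment> \<open>A minor of two neighbours of \<open>i\<close> is a unit in the localisation at \<open>P\<close>, so \<open>x\<^sub>i\<close> and \<open>y\<^sub>i\<close>
      themselves, not only powers of them, lie in the localised ideal.\<close>
    have "\<exists>s\<in>carrier (poly_ring n) - P. X i * s \<in> I \<and> Y i * s \<in> I"
      if "i \<in> {1..n}" "X i \<in> P" "Y i \<in> P" for i
    proof -
      obtain j k where jk: "{i, j} \<in> E" "{i, k} \<in> E" "minor j k \<notin> P"
        using minimal_prime_nonproportional_neighbours[OF G P[unfolded I_def] \<open>i \<in> {1..n}\<close> \<open>X i \<in> P\<close> \<open>Y i \<in> P\<close>]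
        by blast
      then show ?thesis
        using vertex_times_minor_mem[OF G jk(1,2)] edge_vertices[OF G jk(1)] edge_vertices[OF G jk(2)]
        unfolding I_def by (intro bexI[of _ "minor j k"]) (simp_all add: parity_binomial_carrier)
    qed
    then obtain s t where
      s: "s \<in> carrier (poly_ring n)" "s \<notin> P" "X (w 1) * s \<in> I" "Y (w 1) * s \<in> I" and
      t: "t \<in> carrier (poly_ring n)" "t \<notin> P" "X (w 5) * t \<in> I" "Y (w 5) * t \<in> I"
      using True vert by (metis Diff_iff insert_subset)
    have "?g * ?h * (s * t) =
        ?h * ((X (w 1) * s) * (X (w 5) * t) - (Y (w 1) * s) * (Y (w 5) * t))"
      by (simp add: parity_binomial_def algebra_simps)
    also have "\<dots> \<in> ideal_prod (poly_ring n) I I"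
      by (intro square h square_mem s t)
    finally show ?thesis
      using s(1,2) t(1,2) primeideal_poly_ring_mult[OF prime s(1) t(1)]
      by (intro bexI[of _ "s * t"]) (auto intro: poly_ring_carrier_intros)
  qed
  then show "\<exists>s\<in>carrier (poly_ring n) - P. ?g * ?h \<otimes>\<^bsub>poly_ring n\<^esub> s \<in> ideal_power (poly_ring n) I 2"
    by (simp add: ideal_power_2[OF idl])
qed

text \<open>The pair \<open>(x, y)\<close> is \<open>(1, 0)\<close> at vertex \<open>3\<close> and \<open>(0, 1)\<close> at vertices \<open>2\<close> and \<open>4\<close>, which makes
  the binomials of the path \<open>1-2-3-4-5\<close> vanish once \<open>1\<close> and \<open>5\<close> carry \<open>(z, 0)\<close>. With \<open>(z, z)\<close> at
  vertex \<open>6\<close> the three binomials of the triangle are all \<open>z\<^sup>2\<close>, while \<open>minor 4 6\<close> has order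
  only one.\<close>

definition PT_x :: "nat \<Rightarrow> 'k::field poly"
  where "PT_x i = (if i \<in> {1, 5, 6} then [:0, 1:] else if i = 3 then 1 else 0)"

definition PT_y :: "nat \<Rightarrow> 'k::field poly"
  where "PT_y i = (if i = 6 then [:0, 1:] else if i \<in> {2, 4} then 1 else 0)"

lemma PT_arc_edges: "{i, j} \<in> PT_edges \<Longrightarrow> [:0, 1:] ^ 2 dvd PT_x i * PT_x j - PT_y i * PT_y j"
  by (auto simp: PT_edges_def doubleton_eq_iff PT_x_def PT_y_def power2_eq_square)

text \<open>Vertices outside the PT are sent to the origin, so that edges leaving the PT contribute
  nothing; here it matters that the PT is an induced subgraph.\<close>

definition PT_arc :: "nat set \<Rightarrow> (nat \<Rightarrow> nat) \<Rightarrow> var \<Rightarrow> 'k::field poly"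
  where "PT_arc W f v =
    (case v of xvar i \<Rightarrow> if i \<in> W then PT_x (f i) else 0 | yvar i \<Rightarrow> if i \<in> W then PT_y (f i) else 0)"

interpretation arc: poly_subst "\<lambda>c. [:c:]" "PT_arc W f"
  for W and f :: "nat \<Rightarrow> nat"
  by unfold_locales (simp_all add: one_pCons)

text \<open>The order of vanishing along the arc is at least \<open>2\<close> on the ideal, hence at least \<open>4\<close> on its
  square, but it is \<open>3\<close> on the separating polynomial.\<close>

lemma PT_polynomial_not_mem_square:
  assumes G: "finite_simple_graph {1..n} E"
    and f: "\<And>i j. i \<in> W \<Longrightarrow> j \<in> W \<Longrightarrow> {i, j} \<in> E \<Longrightarrow> {f i, f j} \<in> PT_edges"
    and w: "\<And>k. k \<in> {1..6} \<Longrightarrow> w k \<in> W \<and> f (w k) = k"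
  defines "I \<equiv> parity_binomial_edge_ideal n E :: 'k::field mpoly set"
  shows "parity_binomial (w 1) (w 5) * PT_cofactor w \<notin> ideal_power (poly_ring n) I 2"
proof
  interpret cring "poly_ring n :: 'k mpoly ring" by (rule poly_ring_cring)
  let ?z = "[:0, 1:] :: 'k poly" and ?\<phi> = "arc.subst W f :: 'k mpoly \<Rightarrow> _"
  have idl: "ideal I (poly_ring n)"
    unfolding I_def by (rule parity_binomial_edge_ideal(1)[OF G])
  let ?J = "{p \<in> carrier (poly_ring n). ?z ^ 2 dvd ?\<phi> p}"
  have "I \<subseteq> ?J"
    unfolding I_def
  proof (rule parity_binomial_edge_ideal_subset)
    show "ideal ?J (poly_ring n)"
      by (rule ideal_poly_ringI) (auto simp: arc.subst_simps intro: poly_ring_carrier_intros dvd_add)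
    fix i j assume ij: "{i, j} \<in> E"
    have "?z ^ 2 dvd ?\<phi> (parity_binomial i j)"
      using PT_arc_edges[OF f[OF _ _ ij], where 'a='k]
      by (auto simp: parity_binomial_def arc.subst_simps PT_arc_def)
    then show "parity_binomial i j \<in> ?J"
      using edge_vertices[OF G ij] by (simp add: parity_binomial_carrier)
  qed
  then have I: "?z ^ 2 dvd ?\<phi> p" if "p \<in> I" for p
    using that by blast
  have "?z ^ 4 dvd ?\<phi> p" if "p \<in> ideal_prod (poly_ring n) I I" for p
    using that
  proof induction
    case (prod p q)
    have "?z ^ 2 * ?z ^ 2 dvd ?\<phi> p * ?\<phi> q"
      by (intro mult_dvd_mono I prod)
    then show ?case by (simp add: arc.subst_simps flip: power_add)
  qed (simp add: arc.subst_simps dvd_add)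
  moreover assume "parity_binomial (w 1) (w 5) * PT_cofactor w \<in> ideal_power (poly_ring n) I 2"
  ultimately have "?z ^ 4 dvd ?\<phi> (parity_binomial (w 1) (w 5) * PT_cofactor w)"
    unfolding ideal_power_2[OF idl] by blast
  also have "?\<phi> (parity_binomial (w 1) (w 5) * PT_cofactor w) = - (?z ^ 3)"
    by (simp add: parity_binomial_def PT_cofactor_def minor_def arc.subst_simps PT_arc_def w
        PT_x_def PT_y_def power3_eq_cube)
  finally show False
    using dvd_imp_degree_le[of "?z ^ 4" "?z ^ 3"] by (simp add: degree_power_eq)
qed

theorem theorem2p6:
  fixes n :: nat and E :: "nat set set"
    and S :: "'k::field mpoly ring" and I :: "'k mpoly set"
  defines "S \<equiv> poly_ring n" and "I \<equiv> parity_binomial_edge_ideal n E"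
  assumes "finite_simple_graph {1..n} E"
    and "CHAR('k) \<noteq> 2"
    and "\<And>t::nat. t \<ge> 1 \<Longrightarrow> symbolic_power S I t = ideal_power S I t"
  shows "PT_free {1..n} E"
  unfolding PT_free_def
proof
  assume "\<exists>W\<subseteq>{1..n}. is_PT W (induced_edges E W)"
  then obtain W f where f: "bij_betw f W {1..6}"
    and edges: "\<And>i j. i \<in> W \<Longrightarrow> j \<in> W \<Longrightarrow> {i, j} \<in> E \<longleftrightarrow> {f i, f j} \<in> PT_edges"
    unfolding is_PT_def graph_isomorphic_def induced_edges_def by auto
  define w where "w = inv_into W f"
  have w: "w k \<in> W \<and> f (w k) = k" if "k \<in> {1..6}" for k
    using that f bij_betw_inv_into_right[OF f] bij_betw_apply[OF bij_betw_inv_into[OF f]]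
    unfolding w_def by blast
  have "{w i, w j} \<in> E" if "{i, j} \<in> PT_edges" for i j
  proof -
    have "i \<in> {1..6}" "j \<in> {1..6}"
      using that by (auto simp: PT_edges_def doubleton_eq_iff)
    then show ?thesis
      using that w edges by simp
  qed
  then have "parity_binomial (w 1) (w 5) * PT_cofactor w \<in> symbolic_power S I 2"
    unfolding S_def I_def by (intro PT_polynomial_mem_symbolic_square assms(3))
  moreover have "parity_binomial (w 1) (w 5) * PT_cofactor w \<notin> ideal_power S I 2"
    unfolding S_def I_def
    by (rule PT_polynomial_not_mem_square[OF assms(3), of W f]) (use edges w in blast)+
  ultimately show False
    using assms(5)[of 2] by simp
qed

end
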